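(* Let $N\ge1$, $h>0$, $\tau>0$, and let $\Phi:\mathbb{R}\to\mathbb{R}$ be an antisymmetric activation function (i.e. $\Phi(-r)=-\Phi(r)$ for all $r$) with finite Lipschitz constant $L>0$, of the form $\Phi(r)=g(r)\,r$ with a diffusivity $g$. Consider a residual network chaining any number $m$ of diffusion blocks with time step size $\tau$, grid size $h$ and activation function $\Phi$; that is, for an input $\boldsymbol{f}\in\mathbb{R}^N$ set $\boldsymbol{u}^0=\boldsymbol{f}$ and $$\boldsymbol{u}^{k+1}=\boldsymbol{u}^k+\tau\,\boldsymbol{D}^-_h\big(\Phi(\boldsymbol{D}^+_h\boldsymbol{u}^k)\big),\qquad k=0,\dots,m-1.$$ (a) If $\tau\le\dfrac{h^2}{2L}$, then the network is stable in the $L^\infty$ norm, i.e. for every $\boldsymbol{f}\in\mathbb{R}^N$ the maximum–minimum principle $$\min_{1\le j\le N}f_j\;\le\;u_i^m\;\le\;\max_{1\le j\le N}f_j\qquad(1\le i\le N)$$ holds. (b) If $\tau\le\dfrac{h^2}{4L}$, then the network is also sign stable, i.e. for every $\boldsymbol{f}\in\mathbb{R}^N$ the output signal $\boldsymbol{u}^m$ has no more sign changes than the input signal $\boldsymbol{f}$.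
   Context: Scalar functions are applied componentwise to vectors in $\mathbb{R}^N$. A diffusivity is a function $g:\mathbb{R}\to\mathbb{R}$ that is symmetric ($g(-r)=g(r)$), nonnegative, bounded, and nonincreasing in $|r|$. Discrete signals are vectors $\boldsymbol{u}=(u_i)_{i=1}^N\in\mathbb{R}^N$, sampled with grid size $h$, with reflecting boundary conditions ($u_0=u_1$, $u_{N+1}=u_N$). The forward difference matrix is $(\boldsymbol{D}^+_h\boldsymbol{u})_i=\frac{u_{i+1}-u_i}{h}$ for $1\le i\le N$ (so its $N$-th entry is $0$ by the reflecting boundary condition). The backward difference matrix, which is applied to the fluxes, is $(\boldsymbol{D}^-_h\boldsymbol{v})_i=\frac{v_i-v_{i-1}}{h}$ for $1\le i\le N$ with $v_0:=0$ (the flux across the left boundary is $\Phi(0)=0$ by the reflecting boundary condition). Componentwise, one diffusion block reads $$u_i^{k+1}=u_i^k+\frac{\tau}{h}\left(\Phi\Big(\frac{u^k_{i+1}-u^k_i}{h}\Big)-\Phi\Big(\frac{u^k_i-u^k_{i-1}}{h}\Big)\right).$$ A diffusion block is a residual block $\boldsymbol{u}=\sigma_2(\boldsymbol{f}+\boldsymbol{W}_2\,\sigma_1(\boldsymbol{W}_1\boldsymbol{f}+\boldsymbol{b}_1)+\boldsymbol{b}_2)$ with $\sigma_1=\Phi$, $\sigma_2=\mathrm{Id}$, $\boldsymbol{W}_1=\boldsymbol{D}^+_h$, $\boldsymbol{W}_2=\tau\boldsymbol{D}^-_h$, $\boldsymbol{b}_1=\boldsymbol{b}_2=\boldsymbol{0}$.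 The number of sign changes of a signal $(u_1,\dots,u_N)$ is the number of sign changes in the finite sequence obtained by deleting its zero entries. *)

theory Defs
  imports "HOL-Analysis.Lipschitz" "Jordan_Normal_Form.Matrix"
begin

definition diffusivity :: "(real \<Rightarrow> real) \<Rightarrow> bool" where
  "diffusivity g \<longleftrightarrow>
     (\<forall>r. g (- r) = g r) \<and> (\<forall>r. 0 \<le> g r) \<and> bounded (range g) \<and>
     (\<forall>r s. \<bar>r\<bar> \<le> \<bar>s\<bar> \<longrightarrow> g s \<le> g r)"

(* Signals of length N are vectors in carrier_vec N with indices 0, ..., N - 1.
   The reflecting boundary u_(N+1) = u_N makes the last row of the forward
   difference matrix zero. The first row of the backward difference matrix uses
   the value 0 (no flux) to the left of the signal. *)

definition forward_diff :: "nat \<Rightarrow> real \<Rightarrow> real mat" where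
  "forward_diff N h = mat N N (\<lambda>(i, j).
     if i + 1 < N then (if j = i + 1 then 1 / h else if j = i then - 1 / h else 0) else 0)"

definition backward_diff :: "nat \<Rightarrow> real \<Rightarrow> real mat" where
  "backward_diff N h = mat N N (\<lambda>(i, j).
     if j = i then 1 / h else if j + 1 = i then - 1 / h else 0)"

definition residual_block ::
  "(real \<Rightarrow> real) \<Rightarrow> (real \<Rightarrow> real) \<Rightarrow> real mat \<Rightarrow> real vec \<Rightarrow> real mat \<Rightarrow> real vec \<Rightarrow> real vec \<Rightarrow> real vec"
where
  "residual_block \<sigma>1 \<sigma>2 W1 b1 W2 b2 f =
     map_vec \<sigma>2 (f + W2 *\<^sub>v map_vec \<sigma>1 (W1 *\<^sub>v f + b1) + b2)"

definition diffusion_block :: "nat \<Rightarrow> real \<Rightarrow> real \<Rightarrow> (real \<Rightarrow> real) \<Rightarrow> real vec \<Rightarrow> real vec" where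
  "diffusion_block N h \<tau> \<Phi> =
     residual_block \<Phi> id (forward_diff N h) (0\<^sub>v N) (\<tau> \<cdot>\<^sub>m backward_diff N h) (0\<^sub>v N)"

definition diffusion_network ::
  "nat \<Rightarrow> real \<Rightarrow> real \<Rightarrow> (real \<Rightarrow> real) \<Rightarrow> nat \<Rightarrow> real vec \<Rightarrow> real vec"
where
  "diffusion_network N h \<tau> \<Phi> m = diffusion_block N h \<tau> \<Phi> ^^ m"

definition sign_changes :: "real vec \<Rightarrow> nat" where
  "sign_changes u =
     (let xs = filter (\<lambda>x. x \<noteq> 0) (list_of_vec u)
      in card {i. i + 1 < length xs \<and> sgn (xs ! i) \<noteq> sgn (xs ! (i + 1))})"

lemma forward_diff_carrier [simp]: "forward_diff N h \<in> carrier_mat N N"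
  by (simp add: forward_diff_def)

lemma backward_diff_carrier [simp]: "backward_diff N h \<in> carrier_mat N N"
  by (simp add: backward_diff_def)

lemma forward_diff_index:
  assumes u: "u \<in> carrier_vec N" and i: "i < N"
  shows "(forward_diff N h *\<^sub>v u) $ i = (if i + 1 < N then (u $ (i + 1) - u $ i) / h else 0)"
proof -
  have "(forward_diff N h *\<^sub>v u) $ i =
      (\<Sum>j<N. (if i + 1 < N then (if j = i + 1 then 1 / h else if j = i then - 1 / h else 0) else 0) * u $ j)"
    using u i by (simp add: forward_diff_def scalar_prod_def atLeast0LessThan)
  also have "\<dots> = (if i + 1 < N then
      (\<Sum>j<N. (if j = i + 1 then u $ j / h else 0) + (if j = i then - u $ j / h else 0)) else 0)"
    by (auto intro!: sum.cong)
  also have "\<dots> = (if i + 1 < N then (u $ (i + 1) - u $ i) / h else 0)"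
    using i by (simp add: sum.distrib diff_divide_distrib)
  finally show ?thesis .
qed

lemma backward_diff_index:
  assumes v: "v \<in> carrier_vec N" and i: "i < N"
  shows "(backward_diff N h *\<^sub>v v) $ i = (v $ i - (if i = 0 then 0 else v $ (i - 1))) / h"
proof -
  have "(backward_diff N h *\<^sub>v v) $ i =
      (\<Sum>j<N. (if j = i then 1 / h else if j + 1 = i then - 1 / h else 0) * v $ j)"
    using v i by (simp add: backward_diff_def scalar_prod_def atLeast0LessThan)
  also have "\<dots> = (\<Sum>j<N. (if j = i then v $ j / h else 0) +
      (if j = i - 1 then (if i = 0 then 0 else - v $ j / h) else 0))"
    by (auto intro!: sum.cong)
  also have "\<dots> = (v $ i - (if i = 0 then 0 else v $ (i - 1))) / h"
    using i by (auto simp: sum.distrib diff_divide_distrib)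
  finally show ?thesis .
qed

lemma diffusion_block_eq:
  assumes u: "u \<in> carrier_vec N"
  shows "diffusion_block N h \<tau> \<Phi> u =
    u + \<tau> \<cdot>\<^sub>v (backward_diff N h *\<^sub>v map_vec \<Phi> (forward_diff N h *\<^sub>v u))"
proof -
  have [simp]: "forward_diff N h *\<^sub>v u \<in> carrier_vec N"
    using u by (rule mult_mat_vec_carrier[OF forward_diff_carrier])
  have "(\<tau> \<cdot>\<^sub>m backward_diff N h) *\<^sub>v w = \<tau> \<cdot>\<^sub>v (backward_diff N h *\<^sub>v w)"
    if "w \<in> carrier_vec N" for w
    using that by (intro eq_vecI)
      (auto simp: scalar_prod_def backward_diff_def sum_distrib_left mult.assoc)
  moreover have "map_vec \<Phi> (forward_diff N h *\<^sub>v u) \<in> carrier_vec N"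
    by simp
  ultimately show ?thesis
    using u unfolding diffusion_block_def residual_block_def
    by (intro eq_vecI) (auto simp: backward_diff_def forward_diff_def)
qed

end

theory Submission
  imports Defs
begin

text \<open>
  Since \<open>\<Phi> r = g r * r\<close> and \<open>g r \<le> L\<close> for \<open>r \<noteq> 0\<close>, one block multiplies the signal by a symmetric
  tridiagonal matrix with unit row sums whose off-diagonal entries (which depend on the signal) lie
  between \<open>0\<close> and \<open>\<tau> L / h\<^sup>2\<close>. If these are at most \<open>1/2\<close>, then every row is a convex
  combination. If they are at most \<open>1/4\<close>, then the matrix is the product of a lower and an upper
  bidiagonal matrix with nonnegative entries, and a nonnegative bidiagonal matrix does not increase
  the number of sign changes: each new entry lies in the cone spanned by two neighbouring old ones.
\<close>

section \<open>Sign changes of a list with a prescribed preceding sign\<close>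

unbundle no vec_syntax

text \<open>The argument \<open>s\<close> carries the sign of the last nonzero entry before the list.\<close>

fun changes_from :: "real \<Rightarrow> real list \<Rightarrow> nat" where
  "changes_from s [] = 0"
| "changes_from s (x # xs) = (if s * x < 0 then Suc (changes_from x xs) else changes_from s xs)"

lemma changes_from_same_sign:
  "s * t > 0 \<Longrightarrow> changes_from s xs = changes_from t xs"
proof (induction xs)
  case (Cons x xs)
  then have "s * x < 0 \<longleftrightarrow> t * x < 0"
    by (auto simp: mult_less_0_iff zero_less_mult_iff)
  with Cons show ?case by simp
qed simp

text \<open>Two counts with different starting signs agree again after the first nonzero entry,
  where at most one of them gains a change.\<close>

lemma changes_from_le_Suc:
  "s \<noteq> 0 \<Longrightarrow> t \<noteq> 0 \<Longrightarrow> changes_from s xs \<le> Suc (changes_from t xs)"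
proof (induction xs arbitrary: s t)
  case (Cons x xs)
  then have IH: "changes_from s xs \<le> Suc (changes_from t xs)" by simp
  show ?case
  proof (cases "s * x < 0")
    case sx: True
    show ?thesis
    proof (cases "t * x < 0")
      case True
      then show ?thesis using sx by simp
    next
      case False
      then have "t * x > 0" using sx Cons.prems by (auto simp: not_less le_less)
      then show ?thesis using sx changes_from_same_sign[of t x xs] by simp
    qed
  next
    case sx: False
    show ?thesis
    proof (cases "t * x < 0")
      case True
      then have "s * x > 0" using sx Cons.prems by (auto simp: not_less le_less)
      then show ?thesis using sx True changes_from_same_sign[of s x xs] by simp
    next
      case False
      then show ?thesis using sx IH by simp
    qed
  qed
qed simp

text \<open>If \<open>x\<close> has the sign opposite to \<open>s\<close>, the change charged at
  \<open>x\<close> pays for continuing from \<open>x\<close> instead of \<open>s\<close>.\<close>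

lemma changes_from_Cons_ge:
  assumes "s \<noteq> 0"
  shows "changes_from s xs \<le> changes_from s (x # xs)"
  using changes_from_le_Suc[OF assms, of x xs] by (cases "x = 0") auto

lemma changes_from_filter_nonzero:
  "changes_from s (filter (\<lambda>x. x \<noteq> 0) xs) = changes_from s xs"
  by (induction xs arbitrary: s) auto

lemma changes_from_snoc_zero: "changes_from s (xs @ [0]) = changes_from s xs"
  by (induction xs arbitrary: s) auto

text \<open>If \<open>y\<close> has the sign opposite to \<open>s\<close>, so has one of the entries
  \<open>x\<close>, \<open>x'\<close> that span its cone. Hence \<open>xs\<close> has switched sign
  at \<open>x'\<close> at the latest, and both counts continue with the same sign. If
  \<open>y\<close> does not switch, dropping \<open>x\<close> from \<open>xs\<close> only lowers the
  bound.\<close>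

lemma changes_from_cone:
  assumes "length xs = Suc (length ys)" and "s \<noteq> 0"
    and "\<And>i. i < length ys \<Longrightarrow>
      \<exists>p q. p \<ge> 0 \<and> q \<ge> 0 \<and> ys ! i = p * xs ! i + q * xs ! Suc i"
  shows "changes_from s ys \<le> changes_from s xs"
  using assms
proof (induction ys arbitrary: xs s)
  case (Cons y ys)
  obtain x x' zs where xs: "xs = x # x' # zs"
    using Cons.prems(1) by (auto simp: length_Suc_conv)
  obtain p q where pq: "p \<ge> 0" "q \<ge> 0" "y = p * x + q * x'"
    using Cons.prems(3)[of 0] xs by auto
  have IH: "changes_from t ys \<le> changes_from t (x' # zs)" if "t \<noteq> 0" for t
  proof (rule Cons.IH[OF _ that])
    show "length (x' # zs) = Suc (length ys)"
      using Cons.prems(1) xs by simp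
    show "\<exists>p q. p \<ge> 0 \<and> q \<ge> 0 \<and> ys ! i = p * (x' # zs) ! i + q * (x' # zs) ! Suc i"
      if "i < length ys" for i
      using Cons.prems(3)[of "Suc i"] that xs by simp
  qed
  show ?case
  proof (cases "s * y < 0")
    case False
    then show ?thesis
      using IH[OF Cons.prems(2)] changes_from_Cons_ge[OF Cons.prems(2), of "x' # zs" x] xs by simp
  next
    case sy: True
    then have "y \<noteq> 0" by auto
    note le = IH[OF this]
    show ?thesis
    proof (cases "s * x < 0")
      case True
      with sy have "y * x > 0"
        by (auto simp: mult_less_0_iff zero_less_mult_iff)
      from changes_from_same_sign[OF this, of "x' # zs"] True sy le xs show ?thesis
        by (auto simp del: changes_from.simps simp add: changes_from.simps(2)[of s])
    next
      case sx: False
      have "s * y = p * (s * x) + q * (s * x')"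
        using pq(3) by (simp add: algebra_simps)
      moreover have "p * (s * x) \<ge> 0" using sx pq(1) by simp
      ultimately have "q * (s * x') < 0" using sy by linarith
      then have sx': "s * x' < 0"
        using pq(2) by (auto simp: mult_less_0_iff)
      with sy have yx': "y * x' > 0"
        by (auto simp: mult_less_0_iff zero_less_mult_iff)
      from changes_from_same_sign[OF yx', of zs] yx' sx sx' sy le xs show ?thesis
        by simp
    qed
  qed
qed simp

lemma card_sign_changes_eq:
  assumes "x \<noteq> 0" "0 \<notin> set xs"
  shows "card {i. i + 1 < length (x # xs) \<and> sgn ((x # xs) ! i) \<noteq> sgn ((x # xs) ! (i + 1))}
    = changes_from x xs"
  using assms
proof (induction xs arbitrary: x)
  case (Cons y ys)
  let ?S = "\<lambda>xs :: real list. {i. i + 1 < length xs \<and> sgn (xs ! i) \<noteq> sgn (xs ! (i + 1))}"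
  have IH: "card (?S (y # ys)) = changes_from y ys"
    using Cons.IH[of y] Cons.prems by simp
  have fin: "finite (?S (y # ys))"
    by (rule finite_subset[of _ "{..<length (y # ys)}"]) auto
  have split: "?S (x # y # ys) = (if sgn x \<noteq> sgn y then {0} else {}) \<union> Suc ` ?S (y # ys)"
  proof (rule Set.set_eqI)
    fix i show "i \<in> ?S (x # y # ys) \<longleftrightarrow>
      i \<in> (if sgn x \<noteq> sgn y then {0} else {}) \<union> Suc ` ?S (y # ys)"
      by (cases i) (auto simp: image_iff)
  qed
  show ?case
  proof (cases "x * y < 0")
    case True
    then have "sgn x \<noteq> sgn y" by (auto simp: mult_less_0_iff)
    then have "card (?S (x # y # ys)) = Suc (card (?S (y # ys)))"
      unfolding split using fin by (simp add: card_image)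
    then show ?thesis using IH True by simp
  next
    case False
    then have xy: "x * y > 0" using Cons.prems by (auto simp: not_less le_less)
    then have "sgn x = sgn y" by (auto simp: zero_less_mult_iff)
    then have "card (?S (x # y # ys)) = card (?S (y # ys))"
      unfolding split by (simp add: card_image)
    then show ?thesis using IH False changes_from_same_sign[OF xy, of ys] by simp
  qed
qed simp

text \<open>The starting sign that agrees with the first nonzero entry gives the exact count, the
  other one gives one more. The minimum lets two signals be compared with a common starting sign,
  although their first nonzero entries may differ in sign.\<close>

lemma sign_changes_eq_min:
  "sign_changes u = min (changes_from 1 (list_of_vec u)) (changes_from (- 1) (list_of_vec u))"
proof -
  define xs where "xs = filter (\<lambda>x. x \<noteq> 0) (list_of_vec u)"
  have nz: "0 \<notin> set xs" by (simp add: xs_def)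
  have "sign_changes u = card {i. i + 1 < length xs \<and> sgn (xs ! i) \<noteq> sgn (xs ! (i + 1))}"
    by (simp add: sign_changes_def xs_def Let_def)
  also have "\<dots> = min (changes_from 1 xs) (changes_from (- 1) xs)"
  proof (cases xs)
    case (Cons x ys)
    with nz have "x \<noteq> 0" "0 \<notin> set ys" by auto
    from card_sign_changes_eq[OF this]
    have "card {i. i + 1 < length xs \<and> sgn (xs ! i) \<noteq> sgn (xs ! (i + 1))} = changes_from x ys"
      using Cons by simp
    moreover have "changes_from 1 ys = changes_from x ys" if "x > 0"
      using that by (intro changes_from_same_sign) simp
    moreover have "changes_from (- 1) ys = changes_from x ys" if "x < 0"
      using that by (intro changes_from_same_sign) simp
    ultimately show ?thesis
      using Cons \<open>x \<noteq> 0\<close> by (cases "x > 0") auto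
  qed simp
  finally show ?thesis
    by (simp add: xs_def changes_from_filter_nonzero)
qed

section \<open>Tridiagonal updates: bidiagonal factors and convex combinations\<close>

text \<open>The diagonal of the upper factor in the factorisation of the tridiagonal matrix, where
  \<open>b i\<close> is the weight between the entries \<open>i - 1\<close> and \<open>i\<close>.\<close>

fun pivot :: "(nat \<Rightarrow> real) \<Rightarrow> nat \<Rightarrow> real" where
  "pivot b 0 = 1 - b 0 - b (Suc 0)"
| "pivot b (Suc i) = 1 - b (Suc i) - b (Suc (Suc i)) - (b (Suc i))\<^sup>2 / pivot b i"

text \<open>The value 1/4 is the fixed point of the recursion in the extreme case where all weights
  are 1/4: 1 - 1/4 - 1/4 - (1/4)^2 / (1/4) = 1/4.\<close>

lemma pivot_ge:
  assumes "\<And>i. 0 \<le> b i" "\<And>i. b i \<le> 1 / 4"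
  shows "pivot b i \<ge> 1 / 4"
proof (induction i)
  case 0
  show ?case using assms(2)[of 0] assms(2)[of 1] by simp
next
  case (Suc i)
  have "(b (Suc i))\<^sup>2 / pivot b i \<le> (1 / 4)\<^sup>2 / (1 / 4)"
    using assms Suc.IH by (intro frac_le power_mono) auto
  then show ?case
    using assms(2)[of "Suc i"] assms(2)[of "Suc (Suc i)"] by (simp add: power2_eq_square)
qed

lemma changes_from_tridiagonal:
  fixes u v b :: "nat \<Rightarrow> real"
  assumes b: "\<And>i. 0 \<le> b i" "\<And>i. b i \<le> 1 / 4" "b 0 = 0" "b N = 0" and "s \<noteq> 0"
    and v: "\<And>i. i < N \<Longrightarrow> v i = u i + b (Suc i) * (u (Suc i) - u i) - b i * (u i - u (i - 1))"
  shows "changes_from s (map v [0..<N]) \<le> changes_from s (map u [0..<N])"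
proof -
  \<comment> \<open>\<open>w\<close> is the upper bidiagonal factor applied to \<open>u\<close>. The
    lower factor, with unit diagonal and entries \<open>b i / pivot b (i - 1)\<close> below it, then
    maps \<open>w\<close> to \<open>v\<close>.\<close>
  define w where "w i = pivot b i * u i + b (Suc i) * u (Suc i)" for i
  have d: "pivot b i > 0" for i using pivot_ge[of b i] b(1,2) by simp
  \<comment> \<open>The leading 0 serves as left neighbour for row 0 and costs no sign
    change.\<close>
  have "changes_from s (map v [0..<N]) \<le> changes_from s (0 # map w [0..<N])"
  proof (rule changes_from_cone)
    fix i assume "i < length (map v [0..<N])"
    then have i: "i < N" by simp
    show "\<exists>p q. p \<ge> 0 \<and> q \<ge> 0 \<and> map v [0..<N] ! i
      = p * (0 # map w [0..<N]) ! i + q * (0 # map w [0..<N]) ! Suc i"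
    proof (cases i)
      case 0
      have "v 0 = w 0" using v[of 0] i 0 b(3) by (simp add: w_def algebra_simps)
      then show ?thesis using i 0 by (intro exI[of _ 0] exI[of _ 1]) simp
    next
      case (Suc j)
      \<comment> \<open>The term \<open>(b i)\<^sup>2 / pivot b j\<close> cancels the one subtracted
        in the recursion for \<open>pivot b i\<close>.\<close>
      have "v i = b i / pivot b j * w j + 1 * w i"
      proof -
        have "b i / pivot b j * w j = b i * u j + (b i)\<^sup>2 / pivot b j * u i"
          using d[of j] Suc by (simp add: w_def distrib_left power2_eq_square)
        then show ?thesis
          using v[OF i] Suc by (simp add: w_def algebra_simps)
      qed
      then show ?thesis using i Suc b(1)[of i] d[of j]
        by (intro exI[of _ "b i / pivot b j"] exI[of _ 1]) simp
    qed
  qed (use \<open>s \<noteq> 0\<close> in simp_all)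
  also have "\<dots> = changes_from s (map w [0..<N])" by simp
  \<comment> \<open>The appended 0 stands in for \<open>u N\<close> in the last row, where the
    weight \<open>b N\<close> is 0.\<close>
  also have "\<dots> \<le> changes_from s (map u [0..<N] @ [0])"
  proof (rule changes_from_cone)
    fix i assume "i < length (map w [0..<N])"
    then have i: "i < N" by simp
    show "\<exists>p q. p \<ge> 0 \<and> q \<ge> 0 \<and> map w [0..<N] ! i
      = p * (map u [0..<N] @ [0]) ! i + q * (map u [0..<N] @ [0]) ! Suc i"
      using i b(1)[of "Suc i"] b(4) d[of i]
      by (intro exI[of _ "pivot b i"] exI[of _ "b (Suc i)"])
        (cases "Suc i = N", auto simp: w_def nth_append)
  qed (use \<open>s \<noteq> 0\<close> in simp_all)
  finally show ?thesis by (simp add: changes_from_snoc_zero)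
qed

text \<open>Relative to \<open>c\<close>, the new value is a combination of three nonnegative
  numbers with weights \<open>b i\<close>, \<open>1 - b i - b (Suc i)\<close> and
  \<open>b (Suc i)\<close>; the bound 1/2 keeps the middle one nonnegative.\<close>

lemma lower_bound_tridiagonal:
  fixes u b :: "nat \<Rightarrow> real"
  assumes b: "\<And>i. 0 \<le> b i" "\<And>i. b i \<le> 1 / 2" "b 0 = 0" "b N = 0" and i: "i < N"
    and c: "\<And>j. j < N \<Longrightarrow> c \<le> u j"
  shows "c \<le> u i + b (Suc i) * (u (Suc i) - u i) - b i * (u i - u (i - 1))"
proof -
  have "0 \<le> (1 - b i - b (Suc i)) * (u i - c)"
    using b(2)[of i] b(2)[of "Suc i"] c[OF i] by (intro mult_nonneg_nonneg) auto
  moreover have "0 \<le> b (Suc i) * (u (Suc i) - c)"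
    \<comment> \<open>The value \<open>u N\<close> lies outside the signal and need not be at least
      \<open>c\<close>, but its weight is 0.\<close>
    using b(1)[of "Suc i"] b(4) c[of "Suc i"] i by (cases "Suc i = N") auto
  moreover have "0 \<le> b i * (u (i - 1) - c)"
    using b(1)[of i] c[of "i - 1"] i by auto
  ultimately show ?thesis by (simp add: algebra_simps)
qed

section \<open>One diffusion block as a tridiagonal update\<close>

lemma diffusion_block_dim [simp]: "dim_vec (diffusion_block N h \<tau> \<Phi> u) = N"
  by (simp add: diffusion_block_def residual_block_def backward_diff_def)

text \<open>Because \<open>\<Phi> r = g r * r\<close>, the flux between the entries
  \<open>i - 1\<close> and \<open>i\<close> is a nonnegative multiple of their difference;
  \<open>b i\<close> is this multiple scaled by the step size. The zero weights at 0 and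
  \<open>N\<close> express the reflecting boundary.\<close>

lemma diffusion_block_tridiagonal:
  fixes u :: "real vec"
  assumes "h > 0" "\<tau> > 0" and lip: "L-lipschitz_on UNIV \<Phi>"
    and g: "diffusivity g" and \<Phi>: "\<And>r. \<Phi> r = g r * r" and u: "u \<in> carrier_vec N"
  obtains b :: "nat \<Rightarrow> real" where "\<And>i. 0 \<le> b i" "\<And>i. b i \<le> \<tau> * L / h\<^sup>2" "b 0 = 0" "b N = 0"
    "\<And>i. i < N \<Longrightarrow> diffusion_block N h \<tau> \<Phi> u $ i =
      u $ i + b (Suc i) * (u $ Suc i - u $ i) - b i * (u $ i - u $ (i - 1))"
proof
  \<comment> \<open>The Lipschitz bound does not control \<open>g 0\<close>, so the weight across a zero jump is set to \<open>0\<close>.\<close>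
  define b where "b i = (if 0 < i \<and> i < N \<and> u $ i \<noteq> u $ (i - 1)
    then \<tau> / h\<^sup>2 * g ((u $ i - u $ (i - 1)) / h) else 0)" for i
  have g0: "0 \<le> g r" for r using g by (simp add: diffusivity_def)
  have gL: "g r \<le> L" if "r \<noteq> 0" for r
  proof -
    have "\<bar>\<Phi> r - \<Phi> 0\<bar> \<le> L * \<bar>r - 0\<bar>"
      using lipschitz_onD[OF lip, of r 0] by (simp add: dist_real_def)
    then have "g r * \<bar>r\<bar> \<le> L * \<bar>r\<bar>" using g0[of r] by (simp add: \<Phi> abs_mult)
    then show ?thesis using that by simp
  qed
  have L0: "0 \<le> L" using lipschitz_on_nonneg[OF lip] .
  show "0 \<le> b i" for i using g0 assms(1,2) by (simp add: b_def)
  show "b i \<le> \<tau> * L / h\<^sup>2" for i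
  proof (cases "0 < i \<and> i < N \<and> u $ i \<noteq> u $ (i - 1)")
    case True
    then have "\<tau> / h\<^sup>2 * g ((u $ i - u $ (i - 1)) / h) \<le> \<tau> / h\<^sup>2 * L"
      using assms(1,2) by (intro mult_left_mono gL) auto
    then show ?thesis using True by (simp add: b_def)
  next
    case False
    then have "b i = 0" by (auto simp: b_def)
    then show ?thesis using L0 assms(1,2) by simp
  qed
  show "b 0 = 0" "b N = 0" by (simp_all add: b_def)
  \<comment> \<open>At a zero jump both sides vanish, so the weight chosen there does not alter the
    flux.\<close>
  have flux: "\<tau> / h * \<Phi> ((u $ i - u $ (i - 1)) / h) = b i * (u $ i - u $ (i - 1))"
    if "0 < i" "i < N" for i
    using that by (simp add: b_def \<Phi> power2_eq_square)
  have \<Phi>0: "\<Phi> 0 = 0" by (simp add: \<Phi>)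
  fix i assume i: "i < N"
  let ?v = "map_vec \<Phi> (forward_diff N h *\<^sub>v u)"
  have v: "?v \<in> carrier_vec N" by (simp add: forward_diff_def carrier_vecI)
  \<comment> \<open>For \<open>j = N - 1\<close> the last row of \<open>forward_diff\<close> is zero
    and \<open>\<Phi> 0 = 0\<close>, which matches \<open>b N = 0\<close>.\<close>
  have vi: "\<tau> / h * ?v $ j = b (Suc j) * (u $ Suc j - u $ j)" if "j < N" for j
  proof -
    have "?v $ j = \<Phi> ((forward_diff N h *\<^sub>v u) $ j)"
      using that by (simp add: forward_diff_def)
    also have "\<dots> = \<Phi> (if Suc j < N then (u $ Suc j - u $ j) / h else 0)"
      using forward_diff_index[OF u that, of h] by simp
    finally show ?thesis using flux[of "Suc j"] that \<open>b N = 0\<close>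
      by (cases "Suc j = N") (auto simp: \<Phi>0)
  qed
  have "diffusion_block N h \<tau> \<Phi> u $ i = u $ i + \<tau> * (backward_diff N h *\<^sub>v ?v) $ i"
    unfolding diffusion_block_eq[OF u] using i u by (simp add: backward_diff_def)
  also have "\<dots> = u $ i + \<tau> / h * ?v $ i - \<tau> / h * (if i = 0 then 0 else ?v $ (i - 1))"
    unfolding backward_diff_index[OF v i] by (simp add: diff_divide_distrib right_diff_distrib)
  also have "\<dots> = u $ i + b (Suc i) * (u $ Suc i - u $ i) - b i * (u $ i - u $ (i - 1))"
    using vi[OF i] vi[of "i - 1"] i \<open>b 0 = 0\<close> by auto
  finally show "diffusion_block N h \<tau> \<Phi> u $ i =
      u $ i + b (Suc i) * (u $ Suc i - u $ i) - b i * (u $ i - u $ (i - 1))" .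
qed

section \<open>From one block to the network\<close>

lemma diffusion_network_Suc:
  "diffusion_network N h \<tau> \<Phi> (Suc m) f = diffusion_block N h \<tau> \<Phi> (diffusion_network N h \<tau> \<Phi> m f)"
  by (simp add: diffusion_network_def)

lemma diffusion_network_carrier:
  assumes "f \<in> carrier_vec N"
  shows "diffusion_network N h \<tau> \<Phi> m f \<in> carrier_vec N"
proof (cases m)
  case 0
  then show ?thesis using assms by (simp add: diffusion_network_def)
next
  case (Suc k)
  show ?thesis unfolding Suc diffusion_network_Suc by (rule carrier_vecI) simp
qed

lemma diffusion_block_bounds:
  fixes u :: "real vec"
  assumes "h > 0" "\<tau> > 0" "L > 0" "L-lipschitz_on UNIV \<Phi>" "diffusivity g"
    "\<And>r. \<Phi> r = g r * r" "u \<in> carrier_vec N" and \<tau>: "\<tau> \<le> h\<^sup>2 / (2 * L)"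
    and bounds: "\<And>j. j < N \<Longrightarrow> c \<le> u $ j \<and> u $ j \<le> C" and i: "i < N"
  shows "c \<le> diffusion_block N h \<tau> \<Phi> u $ i \<and> diffusion_block N h \<tau> \<Phi> u $ i \<le> C"
proof -
  obtain b :: "nat \<Rightarrow> real" where b: "\<And>i. 0 \<le> b i" "\<And>i. b i \<le> \<tau> * L / h\<^sup>2" "b 0 = 0" "b N = 0"
    and eq: "\<And>i. i < N \<Longrightarrow> diffusion_block N h \<tau> \<Phi> u $ i =
      u $ i + b (Suc i) * (u $ Suc i - u $ i) - b i * (u $ i - u $ (i - 1))"
    using diffusion_block_tridiagonal[of h \<tau> L \<Phi> g u N] assms by blast
  have "\<tau> * L / h\<^sup>2 \<le> 1 / 2" using \<tau> assms(1,3) by (simp add: field_simps)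
  with b(2) have b2: "b i \<le> 1 / 2" for i by (rule order_trans)
  show ?thesis
  proof
    have "c \<le> u $ i + b (Suc i) * (u $ Suc i - u $ i) - b i * (u $ i - u $ (i - 1))"
      using b b2 i bounds by (intro lower_bound_tridiagonal[where u = "vec_index u"]) auto
    then show "c \<le> diffusion_block N h \<tau> \<Phi> u $ i" using eq[OF i] by simp
    \<comment> \<open>The update with fixed weights is linear, so the upper bound is the lower bound
      for the negated signal.\<close>
    have "- C \<le> - u $ i + b (Suc i) * (- u $ Suc i - - u $ i) - b i * (- u $ i - - u $ (i - 1))"
      using b b2 i bounds by (intro lower_bound_tridiagonal[where u = "\<lambda>j. - u $ j"]) auto
    then show "diffusion_block N h \<tau> \<Phi> u $ i \<le> C" using eq[OF i] by (simp add: algebra_simps)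
  qed
qed

lemma sign_changes_diffusion_block:
  fixes u :: "real vec"
  assumes "h > 0" "\<tau> > 0" "L > 0" "L-lipschitz_on UNIV \<Phi>" "diffusivity g"
    "\<And>r. \<Phi> r = g r * r" and u: "u \<in> carrier_vec N" and \<tau>: "\<tau> \<le> h\<^sup>2 / (4 * L)"
  shows "sign_changes (diffusion_block N h \<tau> \<Phi> u) \<le> sign_changes u"
proof -
  let ?v = "diffusion_block N h \<tau> \<Phi> u"
  obtain b :: "nat \<Rightarrow> real" where b: "\<And>i. 0 \<le> b i" "\<And>i. b i \<le> \<tau> * L / h\<^sup>2" "b 0 = 0" "b N = 0"
    and eq: "\<And>i. i < N \<Longrightarrow> ?v $ i =
      u $ i + b (Suc i) * (u $ Suc i - u $ i) - b i * (u $ i - u $ (i - 1))"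
    using diffusion_block_tridiagonal[of h \<tau> L \<Phi> g u N] assms by blast
  have "\<tau> * L / h\<^sup>2 \<le> 1 / 4" using \<tau> assms(1,3) by (simp add: field_simps)
  with b(2) have b4: "b i \<le> 1 / 4" for i by (rule order_trans)
  have lists: "list_of_vec u = map (vec_index u) [0..<N]" "list_of_vec ?v = map (vec_index ?v) [0..<N]"
    using u by (auto simp: list_eq_iff_nth_eq list_of_vec_index)
  \<comment> \<open>Comparing the counts for each starting sign separately also compares their
    minima.\<close>
  have "changes_from s (list_of_vec ?v) \<le> changes_from s (list_of_vec u)" if "s \<noteq> 0" for s
    unfolding lists by (rule changes_from_tridiagonal[of b N s "vec_index ?v" "vec_index u"])
      (use b(1,3,4) b4 that eq in auto)
  then show ?thesis
    unfolding sign_changes_eq_min by (intro min.mono) simp_all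
qed

theorem proposition2:
  fixes N m :: nat and h \<tau> L :: real and \<Phi> g :: "real \<Rightarrow> real"
  assumes "N \<ge> 1" and "h > 0" and "\<tau> > 0" and "L > 0"
    and "\<And>r. \<Phi> (- r) = - \<Phi> r"
    and "L-lipschitz_on UNIV \<Phi>"
    and "diffusivity g"
    and "\<And>r. \<Phi> r = g r * r"
  shows "(\<tau> \<le> h\<^sup>2 / (2 * L) \<longrightarrow>
           (\<forall>f \<in> carrier_vec N. \<forall>i < N.
              Min {f $ j | j. j < N} \<le> diffusion_network N h \<tau> \<Phi> m f $ i \<and>
              diffusion_network N h \<tau> \<Phi> m f $ i \<le> Max {f $ j | j. j < N})) \<and>
         (\<tau> \<le> h\<^sup>2 / (4 * L) \<longrightarrow>
           (\<forall>f \<in> carrier_vec N.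
              sign_changes (diffusion_network N h \<tau> \<Phi> m f) \<le> sign_changes f))"
proof (intro conjI impI ballI allI)
  fix f :: "real vec" and i
  assume \<tau>: "\<tau> \<le> h\<^sup>2 / (2 * L)" and f: "f \<in> carrier_vec N" and i: "i < N"
  let ?lo = "Min {f $ j | j. j < N}" and ?hi = "Max {f $ j | j. j < N}"
  have fin: "finite {f $ j | j. j < N}" by simp
  have "?lo \<le> diffusion_network N h \<tau> \<Phi> m f $ i \<and> diffusion_network N h \<tau> \<Phi> m f $ i \<le> ?hi"
    using i
  proof (induction m arbitrary: i)
    case 0
    then have "f $ i \<in> {f $ j | j. j < N}" by blast
    then show ?case
      using Min_le[OF fin] Max_ge[OF fin] by (simp add: diffusion_network_def)
  next
    case (Suc m)
    \<comment> \<open>The bounds stay those of the input \<open>f\<close>; only the weights change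
      from block to block.\<close>
    show ?case unfolding diffusion_network_Suc
      by (rule diffusion_block_bounds[of h \<tau> L \<Phi> g])
        (fact assms(2-4,6-8) diffusion_network_carrier[OF f] \<tau> Suc.IH Suc.prems)+
  qed
  then show "?lo \<le> diffusion_network N h \<tau> \<Phi> m f $ i" "diffusion_network N h \<tau> \<Phi> m f $ i \<le> ?hi"
    by simp_all
next
  fix f :: "real vec"
  assume \<tau>: "\<tau> \<le> h\<^sup>2 / (4 * L)" and f: "f \<in> carrier_vec N"
  show "sign_changes (diffusion_network N h \<tau> \<Phi> m f) \<le> sign_changes f"
  proof (induction m)
    case 0
    show ?case by (simp add: diffusion_network_def)
  next
    case (Suc m)
    show ?case unfolding diffusion_network_Suc
      by (rule order_trans[OF sign_changes_diffusion_block[of h \<tau> L \<Phi> g] Suc.IH])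
        (fact assms(2-4,6-8) diffusion_network_carrier[OF f] \<tau>)+
  qed
qed

end
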